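(* The following hold. (i) $\mathrm{H}^-(\mathbb{R}) \subsetneq I_3(\mathrm{H}(\mathbb{R}))$ and $\mathrm{H}(\mathbb{R}) = I_4(\mathrm{H}(\mathbb{R}))$. (ii) $\mathrm{PLF}(\mathbb{R}) \supsetneq I_\infty(\mathrm{PLF}(\mathbb{R}))$. (iii) $\mathrm{PL}^-(\mathbb{R}) \subsetneq I_3(\mathrm{PL}(\mathbb{R}))$ and $\mathrm{PL}(\mathbb{R})=I_4(\mathrm{PL}(\mathbb{R}))$.
   Context: $\mathrm{H}(\mathbb{R})$ is the group (under composition) of all homeomorphisms of the real line $\mathbb{R}$. $\mathrm{PLF}(\mathbb{R})$ is the group of piecewise linear homeomorphisms of $\mathbb{R}$ that are locally affine at all but a finite number of points of $\mathbb{R}$. $\mathrm{PL}(\mathbb{R})$ is the group of piecewise linear homeomorphisms of $\mathbb{R}$ that are locally affine at all but a discrete set of points of $\mathbb{R}$. $\mathrm{H}^-(\mathbb{R})$ and $\mathrm{PL}^-(\mathbb{R})$ are the sets of orientation reversing (strictly decreasing) elements of $\mathrm{H}(\mathbb{R})$ and $\mathrm{PL}(\mathbb{R})$ respectively. Let $G$ be a group. An involution in $G$ is an element whose square is the identity (so the identity counts as an involution). For $n=1,2,\dots$, $I_n(G)$ is the set of all products $\tau_1\tau_2\cdots\tau_n$ with each $\tau_i$ an involution in $G$, and $I_\infty(G)=\bigcup_{n\ge 1} I_n(G)$ is the subgroup of $G$ generated by involutions. *)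

theory Defs
  imports "HOL-Analysis.Analysis" "HOL-Algebra.Generated_Groups"
begin

definition HR :: "(real \<Rightarrow> real) monoid" where
  "HR = \<lparr>carrier = {f. \<exists>g. homeomorphism UNIV UNIV f g}, mult = (\<circ>), one = id\<rparr>"

definition locally_affine_at :: "(real \<Rightarrow> real) \<Rightarrow> real \<Rightarrow> bool" where
  "locally_affine_at f x \<longleftrightarrow>
     (\<exists>U a b. open U \<and> x \<in> U \<and> (\<forall>y\<in>U. f y = a * y + b))"

definition breakpoints :: "(real \<Rightarrow> real) \<Rightarrow> real set" where
  "breakpoints f = {x. \<not> locally_affine_at f x}"

text \<open>
  The set of breakpoints is always closed (see \<open>closed_breakpoints\<close>), so for it
  discreteness as a subspace is the same as having no accumulation point in the line.
\<close>
definition PLR :: "(real \<Rightarrow> real) monoid" where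
  "PLR = HR\<lparr>carrier := {f \<in> carrier HR. discrete (breakpoints f)}\<rparr>"

definition PLFR :: "(real \<Rightarrow> real) monoid" where
  "PLFR = HR\<lparr>carrier := {f \<in> carrier HR. finite (breakpoints f)}\<rparr>"

definition orientation_reversing :: "(real \<Rightarrow> real) monoid \<Rightarrow> (real \<Rightarrow> real) set" where
  "orientation_reversing G = {f \<in> carrier G. \<forall>x y. x < y \<longrightarrow> f y < f x}"

definition involutions :: "('a, 'b) monoid_scheme \<Rightarrow> 'a set" where
  "involutions G = {t \<in> carrier G. t \<otimes>\<^bsub>G\<^esub> t = \<one>\<^bsub>G\<^esub>}"

definition inv_prods :: "nat \<Rightarrow> ('a, 'b) monoid_scheme \<Rightarrow> 'a set" where
  "inv_prods n G =
     {foldr (\<otimes>\<^bsub>G\<^esub>) ts \<one>\<^bsub>G\<^esub> | ts. length ts = n \<and> set ts \<subseteq> involutions G}"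

definition inv_prods_inf :: "('a, 'b) monoid_scheme \<Rightarrow> 'a set" where
  "inv_prods_inf G = (\<Union>n\<in>{1..}. inv_prods n G)"

lemma carrier_HR: "f \<in> carrier HR \<longleftrightarrow> (\<exists>g. homeomorphism UNIV UNIV f g)"
  by (simp add: HR_def)

lemma HR_simps [simp]: "f \<otimes>\<^bsub>HR\<^esub> g = f \<circ> g" "\<one>\<^bsub>HR\<^esub> = id"
  by (simp_all add: HR_def)

lemma group_HR: "group HR"
proof (rule groupI)
  fix f g assume "f \<in> carrier HR" "g \<in> carrier HR"
  then show "f \<otimes>\<^bsub>HR\<^esub> g \<in> carrier HR"
    by (auto simp: carrier_HR intro: homeomorphism_compose)
next
  show "\<one>\<^bsub>HR\<^esub> \<in> carrier HR"
    by (auto simp: carrier_HR homeomorphism_def intro!: exI[of _ id])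
next
  fix f assume "f \<in> carrier HR"
  then obtain g where g: "homeomorphism UNIV UNIV f g"
    by (auto simp: carrier_HR)
  then have "g \<in> carrier HR" "g \<otimes>\<^bsub>HR\<^esub> f = \<one>\<^bsub>HR\<^esub>"
    by (auto simp: carrier_HR homeomorphism_def)
  then show "\<exists>y\<in>carrier HR. y \<otimes>\<^bsub>HR\<^esub> f = \<one>\<^bsub>HR\<^esub>"
    by blast
qed (auto simp: o_assoc)

lemma homeomorphism_HR_inv:
  assumes "f \<in> carrier HR"
  shows "homeomorphism UNIV UNIV f (inv\<^bsub>HR\<^esub> f)"
proof -
  interpret group HR by (rule group_HR)
  obtain g where g: "homeomorphism UNIV UNIV f g"
    using assms by (auto simp: carrier_HR)
  then have "g \<in> carrier HR" "g \<otimes>\<^bsub>HR\<^esub> f = \<one>\<^bsub>HR\<^esub>"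
    by (auto simp: carrier_HR homeomorphism_def)
  then have "inv\<^bsub>HR\<^esub> f = g"
    using assms inv_equality by blast
  with g show ?thesis by simp
qed

lemma closed_breakpoints: "closed (breakpoints f)"
proof -
  have "- breakpoints f = {x. locally_affine_at f x}"
    by (auto simp: breakpoints_def)
  moreover have "open {x. locally_affine_at f x}"
    by (subst open_subopen) (fastforce simp: locally_affine_at_def)
  ultimately show ?thesis
    by (simp add: closed_def)
qed

lemma discrete_breakpoints_iff:
  "discrete (breakpoints f) \<longleftrightarrow> (\<forall>x. \<not> x islimpt breakpoints f)"
  using closed_breakpoints[of f]
  by (auto simp: discrete_def isolated_in_islimpt_iff closed_limpt)

lemma breakpoints_id [simp]: "breakpoints id = {}"
proof -
  have "locally_affine_at id x" for x
    unfolding locally_affine_at_def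
    by (rule exI[of _ UNIV], rule exI[of _ 1], rule exI[of _ 0]) simp
  then show ?thesis by (simp add: breakpoints_def)
qed

lemma locally_affine_at_compose:
  assumes g: "locally_affine_at g x" and f: "locally_affine_at f (g x)"
    and cont: "continuous_on UNIV g"
  shows "locally_affine_at (f \<circ> g) x"
proof -
  obtain U a b where U: "open U" "x \<in> U" "\<forall>y\<in>U. g y = a * y + b"
    using g unfolding locally_affine_at_def by blast
  obtain V c d where V: "open V" "g x \<in> V" "\<forall>y\<in>V. f y = c * y + d"
    using f unfolding locally_affine_at_def by blast
  have "open (U \<inter> g -` V)"
    using U V cont by (intro open_Int open_vimage)
  moreover have "\<forall>y \<in> U \<inter> g -` V. (f \<circ> g) y = (c * a) * y + (c * b + d)"
    using U V by (auto simp: algebra_simps)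
  ultimately show ?thesis
    unfolding locally_affine_at_def using U V by blast
qed

lemma locally_affine_at_inverse:
  assumes h: "homeomorphism UNIV UNIV f g" and f: "locally_affine_at f (g x)"
  shows "locally_affine_at g x"
proof -
  obtain U a b where U: "open U" "g x \<in> U" "\<forall>y\<in>U. f y = a * y + b"
    using f unfolding locally_affine_at_def by blast
  have fg: "f (g y) = y" and gf: "g (f y) = y" for y
    using h by (auto simp: homeomorphism_def)
  have "a \<noteq> 0"
  proof
    assume "a = 0"
    then have "y = g x" if "y \<in> U" for y
      using U that gf by (metis mult_zero_left)
    then have "U = {g x}" using U by blast
    with U(1) show False using not_open_singleton by blast
  qed
  have "open (g -` U)"
    using U h by (intro open_vimage) (auto simp: homeomorphism_def)
  moreover have "\<forall>y \<in> g -` U. g y = (1 / a) * y + (- b / a)"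
  proof
    fix y assume "y \<in> g -` U"
    then have "y = a * g y + b" using U fg by force
    then show "g y = (1 / a) * y + (- b / a)"
      using \<open>a \<noteq> 0\<close> by (simp add: field_simps)
  qed
  ultimately show ?thesis
    unfolding locally_affine_at_def using U by blast
qed

lemma breakpoints_compose:
  assumes "homeomorphism UNIV UNIV g g'"
  shows "breakpoints (f \<circ> g) \<subseteq> breakpoints g \<union> g' ` breakpoints f"
proof
  fix x assume x: "x \<in> breakpoints (f \<circ> g)"
  have "continuous_on UNIV g" "g' (g x) = x"
    using assms by (auto simp: homeomorphism_def)
  with x show "x \<in> breakpoints g \<union> g' ` breakpoints f"
    using locally_affine_at_compose[of g x f]
    by (force simp: breakpoints_def image_iff)
qed

lemma breakpoints_inverse:
  assumes "homeomorphism UNIV UNIV f g"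
  shows "breakpoints g \<subseteq> f ` breakpoints f"
proof
  fix x assume x: "x \<in> breakpoints g"
  have "f (g x) = x" using assms by (auto simp: homeomorphism_def)
  with x show "x \<in> f ` breakpoints f"
    using locally_affine_at_inverse[OF assms, of x]
    by (force simp: breakpoints_def image_iff)
qed

lemma not_islimpt_homeomorphism_image:
  fixes f g :: "real \<Rightarrow> real"
  assumes h: "homeomorphism UNIV UNIV f g" and S: "\<forall>x. \<not> x islimpt S"
  shows "\<not> x islimpt f ` S"
proof
  assume "x islimpt f ` S"
  have gf: "g (f y) = y" and fg: "f (g y) = y" for y
    using h by (auto simp: homeomorphism_def)
  have cf: "continuous_on UNIV f" using h by (auto simp: homeomorphism_def)
  have "g x islimpt S"
  proof (rule islimptI)
    fix T assume T: "g x \<in> T" "open T"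
    have "open (g -` T)"
      using T h by (intro open_vimage) (auto simp: homeomorphism_def)
    then obtain y where "y \<in> f ` S" "y \<in> g -` T" "y \<noteq> x"
      using islimptE[OF \<open>x islimpt f ` S\<close>, of "g -` T"] T by auto
    then show "\<exists>y\<in>S. y \<in> T \<and> y \<noteq> g x"
      using gf fg by (auto simp: fg)
  qed
  with S show False by blast
qed

lemma subgroup_PLFR: "subgroup (carrier PLFR) HR"
proof -
  interpret group HR by (rule group_HR)
  show ?thesis
  proof
    fix f g assume fg: "f \<in> carrier PLFR" "g \<in> carrier PLFR"
    then have "f \<in> carrier HR" "g \<in> carrier HR" by (simp_all add: PLFR_def)
    then have "f \<otimes>\<^bsub>HR\<^esub> g \<in> carrier HR" by (rule m_closed)
    moreover have "finite (breakpoints (f \<circ> g))"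
      using breakpoints_compose[OF homeomorphism_HR_inv[OF \<open>g \<in> carrier HR\<close>], of f] fg
      by (auto simp: PLFR_def intro: finite_subset)
    ultimately show "f \<otimes>\<^bsub>HR\<^esub> g \<in> carrier PLFR"
      by (simp add: PLFR_def)
  next
    fix f assume f: "f \<in> carrier PLFR"
    then have "f \<in> carrier HR" by (simp add: PLFR_def)
    then show "inv\<^bsub>HR\<^esub> f \<in> carrier PLFR"
      using breakpoints_inverse[OF homeomorphism_HR_inv, of f] f
      by (auto simp: PLFR_def intro: finite_subset)
  next
    have "id \<in> carrier HR" using one_closed by simp
    then show "\<one>\<^bsub>HR\<^esub> \<in> carrier PLFR" by (simp add: PLFR_def)
  qed (simp add: PLFR_def)
qed

lemma subgroup_PLR: "subgroup (carrier PLR) HR"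
proof -
  interpret group HR by (rule group_HR)
  show ?thesis
  proof
    fix f g assume fg: "f \<in> carrier PLR" "g \<in> carrier PLR"
    then have H: "f \<in> carrier HR" "g \<in> carrier HR" by (simp_all add: PLR_def)
    then have "f \<otimes>\<^bsub>HR\<^esub> g \<in> carrier HR" by (rule m_closed)
    moreover have "discrete (breakpoints (f \<circ> g))"
      unfolding discrete_breakpoints_iff
    proof (intro allI notI)
      fix x assume "x islimpt breakpoints (f \<circ> g)"
      note hg = homeomorphism_HR_inv[OF H(2)]
      have "x islimpt breakpoints g \<union> (inv\<^bsub>HR\<^esub> g) ` breakpoints f"
        using \<open>x islimpt _\<close> breakpoints_compose[OF hg] islimpt_subset by blast
      then show False
        using not_islimpt_homeomorphism_image[OF homeomorphism_symD[OF hg], of "breakpoints f"] fg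
        by (auto simp: PLR_def discrete_breakpoints_iff islimpt_Un)
    qed
    ultimately show "f \<otimes>\<^bsub>HR\<^esub> g \<in> carrier PLR"
      by (simp add: PLR_def)
  next
    fix f assume f: "f \<in> carrier PLR"
    then have H: "f \<in> carrier HR" by (simp add: PLR_def)
    note hf = homeomorphism_HR_inv[OF H]
    have "discrete (breakpoints (inv\<^bsub>HR\<^esub> f))"
      using f not_islimpt_homeomorphism_image[OF hf, of "breakpoints f"]
        islimpt_subset[OF _ breakpoints_inverse[OF hf]]
      by (auto simp: PLR_def discrete_breakpoints_iff)
    with H show "inv\<^bsub>HR\<^esub> f \<in> carrier PLR" by (simp add: PLR_def)
  next
    have "id \<in> carrier HR" using one_closed by simp
    then show "\<one>\<^bsub>HR\<^esub> \<in> carrier PLR" by (simp add: PLR_def)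
  qed (simp add: PLR_def)
qed

lemma group_PLR: "group PLR"
  using group.subgroup_imp_group[OF group_HR subgroup_PLR] by (simp add: PLR_def)

lemma group_PLFR: "group PLFR"
  using group.subgroup_imp_group[OF group_HR subgroup_PLFR] by (simp add: PLFR_def)

lemma (in group) inv_prods_inf_eq_generate:
  "inv_prods_inf G = generate G (involutions G)"
proof (intro equalityI subsetI)
  have *: "foldr (\<otimes>) ts \<one> \<in> generate G (involutions G)" if "set ts \<subseteq> involutions G" for ts
    using that by (induction ts) (auto intro: generate.intros)
  fix x assume "x \<in> inv_prods_inf G"
  then show "x \<in> generate G (involutions G)"
    using * by (auto simp: inv_prods_inf_def inv_prods_def)
next
  have cl: "foldr (\<otimes>) ts \<one> \<in> carrier G" if "set ts \<subseteq> involutions G" for ts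
    using that by (induction ts) (auto simp: involutions_def)
  have app: "foldr (\<otimes>) (ts @ us) \<one> = foldr (\<otimes>) ts \<one> \<otimes> foldr (\<otimes>) us \<one>"
    if "set ts \<subseteq> involutions G" "set us \<subseteq> involutions G" for ts us
    using that
  proof (induction ts)
    case (Cons t ts)
    then show ?case
      using cl[of ts] cl[of us] by (auto simp: involutions_def m_assoc)
  qed (use cl in auto)
  have I: "foldr (\<otimes>) ts \<one> \<in> inv_prods_inf G" if "ts \<noteq> []" "set ts \<subseteq> involutions G" for ts
    unfolding inv_prods_inf_def inv_prods_def
    using that by (intro UN_I[of "length ts"]) (auto simp: Suc_le_eq)
  have single: "t \<in> inv_prods_inf G" if "t \<in> involutions G" for t
    using I[of "[t]"] that by (auto simp: involutions_def)
  fix x assume "x \<in> generate G (involutions G)"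
  then show "x \<in> inv_prods_inf G"
  proof (induction rule: generate.induct)
    case one
    then show ?case by (intro single) (auto simp: involutions_def)
  next
    case (incl h)
    then show ?case by (rule single)
  next
    case (inv h)
    then have "inv h = h" by (auto simp: involutions_def intro: inv_equality)
    with inv single show ?case by simp
  next
    case (eng h1 h2)
    then obtain ts us where "h1 = foldr (\<otimes>) ts \<one>" "ts \<noteq> []" "set ts \<subseteq> involutions G"
      "h2 = foldr (\<otimes>) us \<one>" "set us \<subseteq> involutions G"
      by (fastforce simp: inv_prods_inf_def inv_prods_def)
    then show ?case
      using app[of ts us] I[of "ts @ us"] by auto
  qed
qed

end

theory Submission
  imports Defs "HOL-Real_Asymp.Real_Asymp"
begin

text \<open>
  Let \<open>f\<close> be decreasing. Then \<open>max f f\<^sup>-\<^sup>1\<close> is an involution, and shifting its graph along the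
  diagonal gives an involution \<open>r\<close> with \<open>r > f\<close> everywhere. Hence \<open>r \<circ> f\<close> is increasing and lies
  strictly above the identity, so it is conjugate to the translation \<open>x \<mapsto> x + 1\<close>, which is a product
  of two reflections. All constructions stay within piecewise linear maps if \<open>f\<close> is piecewise
  linear. An increasing map becomes decreasing after composition with \<open>x \<mapsto> -x\<close>, which costs a
  fourth involution. With finitely many breakpoints, the product of the two slopes at infinity is
  an obstruction.
\<close>

section \<open>Homeomorphisms of the line\<close>

text \<open>This is invariance of domain in dimension one: a continuous injection of the line is a
  homeomorphism onto its image.\<close>

lemma HR_I:
  assumes "continuous_on UNIV f" "inj f" "surj f"
  shows "f \<in> carrier HR"
  using homeomorphism_into_1d[of UNIV f UNIV] assms
  by (auto simp: carrier_HR)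

lemma HR_D:
  assumes "f \<in> carrier HR"
  shows "continuous_on UNIV f" "inj f" "surj f"
  using assms by (auto simp: carrier_HR homeomorphism_def intro: injI) (metis injI)

lemma HR_monotone:
  assumes "f \<in> carrier HR"
  shows "strict_mono f \<or> strict_antimono_on UNIV f"
  using injective_eq_monotone_map[of UNIV f] HR_D[OF assms] by simp

lemma affine_HR:
  assumes "a \<noteq> 0"
  shows "(\<lambda>x. a * x + b) \<in> carrier HR"
proof (rule HR_I)
  show "surj (\<lambda>x. a * x + b)"
    using assms by (intro surjI[of _ "\<lambda>y. (y - b) / a"]) simp
qed (use assms in \<open>auto intro!: continuous_intros injI\<close>)

lemma affine_PLFR:
  assumes "a \<noteq> 0"
  shows "(\<lambda>x. a * x + b) \<in> carrier PLFR"
proof -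
  have "breakpoints (\<lambda>x. a * x + b) = {}"
    by (auto simp: breakpoints_def locally_affine_at_def intro!: exI[of _ UNIV])
  with affine_HR[OF assms] show ?thesis by (simp add: PLFR_def)
qed

lemma PLFR_subset_PLR: "carrier PLFR \<subseteq> carrier PLR"
  by (auto simp: PLFR_def PLR_def discrete_breakpoints_iff islimpt_finite)

lemmas affine_PLR = subsetD[OF PLFR_subset_PLR affine_PLFR]

lemma comp_HR: "f \<in> carrier HR \<Longrightarrow> g \<in> carrier HR \<Longrightarrow> f \<circ> g \<in> carrier HR"
  using monoid.m_closed[OF group.is_monoid[OF group_HR], of f g] by simp

lemma comp_PLR: "f \<in> carrier PLR \<Longrightarrow> g \<in> carrier PLR \<Longrightarrow> f \<circ> g \<in> carrier PLR"
  using subgroup.m_closed[OF subgroup_PLR, of f g] by simp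

text \<open>The last clause carries piecewise linearity as a conditional conclusion. Later
  constructions keep this form, so that each serves H(R) and PL(R) at once.\<close>

lemma HR_inverse:
  assumes "f \<in> carrier HR"
  obtains g where "g \<in> carrier HR" "\<And>x. f (g x) = x" "\<And>x. g (f x) = x"
    "f \<in> carrier PLR \<Longrightarrow> g \<in> carrier PLR"
proof
  let ?g = "inv\<^bsub>HR\<^esub> f"
  show "?g \<in> carrier HR"
    using group.inv_closed[OF group_HR] assms by blast
  show "f (?g x) = x" "?g (f x) = x" for x
    using homeomorphism_HR_inv[OF assms] by (auto simp: homeomorphism_def)
  show "f \<in> carrier PLR \<Longrightarrow> ?g \<in> carrier PLR"
    using subgroup.m_inv_closed[OF subgroup_PLR] by blast
qed

section \<open>Germs of piecewise linear functions\<close>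

text \<open>The filter parameter covers one-sided germs at a point as well as germs at the two ends
  of the line.\<close>

definition eventually_affine :: "(real \<Rightarrow> real) \<Rightarrow> real filter \<Rightarrow> bool" where
  "eventually_affine f F \<longleftrightarrow> (\<exists>a b. \<forall>\<^sub>F y in F. f y = a * y + b)"

lemma eventually_affine_cong:
  assumes "\<forall>\<^sub>F y in F. f y = g y"
  shows "eventually_affine f F \<longleftrightarrow> eventually_affine g F"
proof -
  have "eventually_affine g F" if f: "eventually_affine f F" and eq: "\<forall>\<^sub>F y in F. f y = g y" for f g
  proof -
    obtain a b where "\<forall>\<^sub>F y in F. f y = a * y + b"
      using f by (auto simp: eventually_affine_def)
    with eq have "\<forall>\<^sub>F y in F. g y = a * y + b"
      by eventually_elim simp
    then show ?thesis by (auto simp: eventually_affine_def)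
  qed
  from this[of f g] this[of g f] assms show ?thesis by (auto simp: eq_commute)
qed

text \<open>The derivative recovers the slope near each point, hence also the intercept. The pair of
  both is locally constant, so it is constant on a connected set.\<close>

lemma locally_affine_imp_affine:
  assumes "open S" "connected S" "\<And>x. x \<in> S \<Longrightarrow> locally_affine_at f x"
  shows "\<exists>a b. \<forall>x\<in>S. f x = a * x + b"
proof -
  let ?coeffs = "\<lambda>x. (deriv f x, f x - deriv f x * x)"
  have loc: "\<exists>T. openin (top_of_set S) T \<and> x \<in> T \<and> (\<forall>y\<in>T. ?coeffs y = ?coeffs x)"
    if x: "x \<in> S" for x
  proof -
    obtain U a b where U: "open U" "x \<in> U" "\<forall>y\<in>U. f y = a * y + b"
      using assms(3)[OF x] by (auto simp: locally_affine_at_def)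
    have "deriv f y = a" if "y \<in> U" for y
    proof -
      have "((\<lambda>y. a * y + b) has_field_derivative a) (at y)"
        by (auto intro!: derivative_eq_intros)
      then have "(f has_field_derivative a) (at y)"
        by (rule has_field_derivative_transform_within_open[OF _ U(1) that]) (use U in auto)
      then show ?thesis by (rule DERIV_imp_deriv)
    qed
    then have "?coeffs y = (a, b)" if "y \<in> U" for y
      using U that by auto
    with U that show ?thesis
      by (intro exI[of _ "S \<inter> U"]) auto
  qed
  obtain p where p: "?coeffs x = p" if "x \<in> S" for x
    using locally_constant_imp_constant[OF assms(2) loc] by (auto simp: constant_on_def)
  then have "f x = fst p * x + snd p" if "x \<in> S" for x
    using that by fastforce
  then show ?thesis by blast
qed

text \<open>Since breakpoints do not accumulate at \<open>x\<close>, a short interval on either side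
  of \<open>x\<close> is free of them, and \<open>f\<close> is affine on each.\<close>

lemma discrete_breakpoints_imp_eventually_affine:
  assumes "discrete (breakpoints f)"
  shows "eventually_affine f (at_left x)" "eventually_affine f (at_right x)"
proof -
  have "\<not> x islimpt breakpoints f"
    using assms by (simp add: discrete_breakpoints_iff)
  then obtain d where d: "d > 0" "\<And>y. y \<noteq> x \<Longrightarrow> dist y x < d \<Longrightarrow> locally_affine_at f y"
    unfolding islimpt_approachable breakpoints_def by auto
  have "\<exists>a b. \<forall>y\<in>{x - d<..<x}. f y = a * y + b" "\<exists>a b. \<forall>y\<in>{x<..<x + d}. f y = a * y + b"
    using d by (auto intro!: locally_affine_imp_affine simp: dist_real_def)
  moreover have "\<forall>\<^sub>F y in at_left x. y \<in> {x - d<..<x}" "\<forall>\<^sub>F y in at_right x. y \<in> {x<..<x + d}"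
    using d eventually_at_left_real[of "x - d" x] eventually_at_right_real[of x "x + d"] by auto
  ultimately show "eventually_affine f (at_left x)" "eventually_affine f (at_right x)"
    unfolding eventually_affine_def by (metis (mono_tags, lifting) eventually_mono)+
qed

lemma discrete_breakpointsI:
  assumes "\<And>x. eventually_affine f (at_left x)" "\<And>x. eventually_affine f (at_right x)"
  shows "discrete (breakpoints f)"
  unfolding discrete_breakpoints_iff
proof
  fix x
  obtain a b where "\<forall>\<^sub>F y in at_left x. f y = a * y + b"
    using assms(1)[of x] by (auto simp: eventually_affine_def)
  then obtain p where p: "p < x" "\<And>y. y \<in> {p<..<x} \<Longrightarrow> f y = a * y + b"
    by (auto simp: eventually_at_left_field)
  obtain c d where "\<forall>\<^sub>F y in at_right x. f y = c * y + d"
    using assms(2)[of x] by (auto simp: eventually_affine_def)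
  then obtain q where q: "x < q" "\<And>y. y \<in> {x<..<q} \<Longrightarrow> f y = c * y + d"
    by (auto simp: eventually_at_right_field)
  have "locally_affine_at f y" if "y \<in> {p<..<x}" for y
    unfolding locally_affine_at_def
    using that p by (intro exI[of _ "{p<..<x}"] exI[of _ a] exI[of _ b]) auto
  moreover have "locally_affine_at f y" if "y \<in> {x<..<q}" for y
    unfolding locally_affine_at_def
    using that q by (intro exI[of _ "{x<..<q}"] exI[of _ c] exI[of _ d]) auto
  ultimately have "y = x" if "y \<in> breakpoints f" "y \<in> {p<..<q}" for y
    using that by (force simp: breakpoints_def not_less)
  with p q show "\<not> x islimpt breakpoints f"
    using islimptE[of x "breakpoints f" "{p<..<q}"] by (metis greaterThanLessThan_iff open_greaterThanLessThan)
qed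

text \<open>Piecewise linearity becomes a pointwise condition on one-sided germs, which is
  convenient for maxima and for maps glued from pieces.\<close>

lemma PLR_iff:
  "f \<in> carrier PLR \<longleftrightarrow>
     f \<in> carrier HR \<and> (\<forall>x. eventually_affine f (at_left x) \<and> eventually_affine f (at_right x))"
  using discrete_breakpoints_imp_eventually_affine[of f] discrete_breakpointsI[of f]
  by (auto simp: PLR_def)

text \<open>By \<open>cut\<close>, the filter settles on one side of every point. Hence one of the
  two affine germs eventually dominates, and the maximum agrees with it.\<close>

lemma eventually_affine_max:
  assumes "eventually_affine f F" "eventually_affine g F"
    and cut: "\<And>z. (\<forall>\<^sub>F y in F. y \<le> z) \<or> (\<forall>\<^sub>F y in F. z \<le> y)"
  shows "eventually_affine (\<lambda>x. max (f x) (g x)) F"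
proof -
  obtain a b where f: "\<forall>\<^sub>F y in F. f y = a * y + b"
    using assms(1) by (auto simp: eventually_affine_def)
  obtain c d where g: "\<forall>\<^sub>F y in F. g y = c * y + d"
    using assms(2) by (auto simp: eventually_affine_def)
  \<comment> \<open>The abscissa where the two lines cross if their slopes differ; parallel lines
    are compared by their intercepts.\<close>
  let ?z = "(d - b) / (a - c)"
  have le: "a * y + b \<le> c * y + d \<longleftrightarrow> (if a < c then ?z \<le> y else if c < a then y \<le> ?z else b \<le> d)" for y
  proof -
    have "a * y + b \<le> c * y + d \<longleftrightarrow> (a - c) * y \<le> d - b" by (auto simp: algebra_simps)
    then show ?thesis
      by (cases a c rule: linorder_cases)
        (simp_all add: pos_le_divide_eq neg_le_divide_eq pos_divide_le_eq neg_divide_le_eq mult.commute)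
  qed
  have ge: "c * y + d \<le> a * y + b \<longleftrightarrow> (if a < c then y \<le> ?z else if c < a then ?z \<le> y else d \<le> b)" for y
  proof -
    have "c * y + d \<le> a * y + b \<longleftrightarrow> d - b \<le> (a - c) * y" by (auto simp: algebra_simps)
    then show ?thesis
      by (cases a c rule: linorder_cases)
        (simp_all add: pos_le_divide_eq neg_le_divide_eq pos_divide_le_eq neg_divide_le_eq mult.commute)
  qed
  have "(\<forall>\<^sub>F y in F. a * y + b \<le> c * y + d) \<or> (\<forall>\<^sub>F y in F. c * y + d \<le> a * y + b)"
    unfolding le ge using cut[of ?z] by (cases a c rule: linorder_cases; cases "b \<le> d") auto
  then show ?thesis
  proof
    assume "\<forall>\<^sub>F y in F. a * y + b \<le> c * y + d"
    with f g have "\<forall>\<^sub>F y in F. max (f y) (g y) = g y" by eventually_elim simp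
    with assms(2) show ?thesis by (simp add: eventually_affine_cong)
  next
    assume "\<forall>\<^sub>F y in F. c * y + d \<le> a * y + b"
    with f g have "\<forall>\<^sub>F y in F. max (f y) (g y) = f y" by eventually_elim simp
    with assms(1) show ?thesis by (simp add: eventually_affine_cong)
  qed
qed

lemma max_PLR:
  assumes "f \<in> carrier PLR" "g \<in> carrier PLR" "(\<lambda>x. max (f x) (g x)) \<in> carrier HR"
  shows "(\<lambda>x. max (f x) (g x)) \<in> carrier PLR"
proof -
  have "(\<forall>\<^sub>F y in at_left x. y \<le> z) \<or> (\<forall>\<^sub>F y in at_left x. z \<le> y)" for x z :: real
  proof (cases "z < x")
    case True
    have "\<forall>\<^sub>F y in at_left x. z \<le> y"
      using eventually_at_left_real[OF True] by eventually_elim simp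
    then show ?thesis ..
  next
    case False
    have "\<forall>\<^sub>F y in at_left x. y \<le> z"
      using eventually_at_left_real[of "x - 1" x, simplified] by eventually_elim (use False in auto)
    then show ?thesis ..
  qed
  moreover have "(\<forall>\<^sub>F y in at_right x. y \<le> z) \<or> (\<forall>\<^sub>F y in at_right x. z \<le> y)" for x z :: real
  proof (cases "x < z")
    case True
    have "\<forall>\<^sub>F y in at_right x. y \<le> z"
      using eventually_at_right_real[OF True] by eventually_elim simp
    then show ?thesis ..
  next
    case False
    have "\<forall>\<^sub>F y in at_right x. z \<le> y"
      using eventually_at_right_real[of x "x + 1", simplified] by eventually_elim (use False in auto)
    then show ?thesis ..
  qed
  ultimately show ?thesis
    using assms by (auto simp: PLR_iff intro!: eventually_affine_max)
qed

section \<open>Decreasing homeomorphisms lie below involutions\<close>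

lemma involutions_HR: "t \<in> involutions HR \<longleftrightarrow> t \<in> carrier HR \<and> (\<forall>x. t (t x) = x)"
  by (auto simp: involutions_def fun_eq_iff)

lemma involutions_HR_I:
  assumes "continuous_on UNIV t" "\<And>x. t (t x) = x"
  shows "t \<in> involutions HR"
  unfolding involutions_HR
proof
  show "t \<in> carrier HR"
    using assms(1)
  proof (rule HR_I)
    show "inj t" using assms(2) by (metis injI)
    show "surj t" using assms(2) by (rule surjI)
  qed
qed (use assms in auto)

text \<open>
  The region on or below the graph of \<open>f\<close> is reflected in the diagonal to the region on or below
  the graph of its inverse \<open>g\<close>, so their union is symmetric and its boundary is the graph of an
  involution.
\<close>
lemma max_inverse_involution:
  assumes "strict_antimono_on UNIV f" "f \<in> carrier HR" "g \<in> carrier HR"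
    and fg: "\<And>x. f (g x) = x" and gf: "\<And>x. g (f x) = x"
  shows "(\<lambda>x. max (f x) (g x)) \<in> involutions HR"
proof (rule involutions_HR_I)
  show "continuous_on UNIV (\<lambda>x. max (f x) (g x))"
    using assms HR_D by (auto intro!: continuous_intros)
  have f_le: "f y \<le> f x" if "x \<le> y" for x y
    using assms(1) that by (auto simp: monotone_on_def order_le_less)
  have g_le: "g y \<le> g x" if "x \<le> y" for x y
    using assms(1) that fg by (metis monotone_on_def UNIV_I linorder_not_le)
  show "max (f (max (f x) (g x))) (g (max (f x) (g x))) = x" for x
  proof (cases "g x \<le> f x")
    case True
    \<comment> \<open>Applying \<open>f\<close> to \<open>g x \<le> f x\<close> gives
      \<open>f (f x) \<le> x = g (f x)\<close>, so the outer maximum is attained by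
      \<open>g\<close>. The other case is symmetric.\<close>
    with f_le[OF True] show ?thesis by (simp add: fg gf max_def)
  next
    case False
    with g_le[of "f x" "g x"] show ?thesis by (auto simp: fg gf max_def)
  qed
qed

text \<open>The maximum \<open>h\<close> of \<open>f\<close> and its inverse only satisfies
  \<open>f x \<le> h x\<close>. Conjugating \<open>h\<close> by the unit translation makes this
  strict, because \<open>h (x - 1) + 1 > h x\<close> for decreasing \<open>h\<close>.\<close>

lemma decreasing_below_involution:
  assumes "strict_antimono_on UNIV f" "f \<in> carrier HR"
  obtains t where "t \<in> involutions HR" "strict_antimono_on UNIV t" "\<And>x. f x < t x"
    "f \<in> carrier PLR \<Longrightarrow> t \<in> carrier PLR"
proof -
  obtain g where g: "g \<in> carrier HR" "\<And>x. f (g x) = x" "\<And>x. g (f x) = x"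
    "f \<in> carrier PLR \<Longrightarrow> g \<in> carrier PLR"
    using HR_inverse[OF assms(2)] by blast
  define h where "h = (\<lambda>x. max (f x) (g x))"
  have h: "h \<in> involutions HR"
    unfolding h_def by (rule max_inverse_involution[OF assms g(1-3)])
  then have hH: "h \<in> carrier HR" and hh: "h (h x) = x" for x
    by (auto simp: involutions_HR)
  have f_less: "f y < f x" if "x < y" for x y
    using assms(1) that by (auto simp: monotone_on_def)
  have g_less: "g y < g x" if "x < y" for x y
    using f_less g(2) that by (metis linorder_less_linear not_less_iff_gr_or_eq)
  have h_less: "h y < h x" if "x < y" for x y
    using f_less[OF that] g_less[OF that] by (auto simp: h_def)
  define t where "t = (\<lambda>x. 1 * x + 1) \<circ> h \<circ> (\<lambda>x. 1 * x + (-1))"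
  have t: "t x = h (x - 1) + 1" for x by (simp add: t_def)
  show ?thesis
  proof
    have "t \<in> carrier HR"
      unfolding t_def by (intro comp_HR affine_HR hH) auto
    then show "t \<in> involutions HR" by (simp add: involutions_HR t hh)
    show "strict_antimono_on UNIV t" using h_less by (auto simp: t monotone_on_def)
    show "f x < t x" for x
      using h_less[of "x - 1" x] by (simp add: t h_def)
    assume "f \<in> carrier PLR"
    then have "h \<in> carrier PLR" unfolding h_def
      using g hH by (intro max_PLR) (auto simp: h_def)
    then show "t \<in> carrier PLR"
      unfolding t_def by (intro comp_PLR affine_PLR) auto
  qed
qed

section \<open>Fixed-point-free homeomorphisms are conjugate to a translation\<close>

text \<open>The two indices differ exactly at integers, where the piece that ends at
  \<open>x\<close> governs the left germ and the piece that starts at \<open>x\<close> governs the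
  right one.\<close>

lemma piecewise_germs:
  fixes c :: "real \<Rightarrow> real" and u :: "int \<Rightarrow> real \<Rightarrow> real"
  assumes "\<And>n x. of_int n \<le> x \<Longrightarrow> x \<le> of_int n + 1 \<Longrightarrow> c x = u n x"
  shows "\<forall>\<^sub>F y in at_right x. c y = u \<lfloor>x\<rfloor> y" "\<forall>\<^sub>F y in at_left x. c y = u (\<lceil>x\<rceil> - 1) y"
proof -
  have "\<forall>\<^sub>F y in at_right x. y \<in> {x<..<of_int \<lfloor>x\<rfloor> + 1}"
    by (rule eventually_at_right_real) linarith
  then show "\<forall>\<^sub>F y in at_right x. c y = u \<lfloor>x\<rfloor> y"
  proof eventually_elim
    case (elim y)
    show ?case using elim by (intro assms) (auto, linarith)
  qed
  have "\<forall>\<^sub>F y in at_left x. y \<in> {of_int (\<lceil>x\<rceil> - 1)<..<x}"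
    by (rule eventually_at_left_real) linarith
  then show "\<forall>\<^sub>F y in at_left x. c y = u (\<lceil>x\<rceil> - 1) y"
  proof eventually_elim
    case (elim y)
    show ?case using elim by (intro assms) (auto, linarith)
  qed
qed

text \<open>The interval from \<open>0\<close> to \<open>g 0\<close> is a fundamental domain for
  \<open>g\<close>. Map the unit interval onto it affinely and extend by the equation
  \<open>c (x + 1) = g (c x)\<close>.\<close>

lemma conjugate_to_translation:
  assumes g: "g \<in> carrier HR" and above: "\<And>x. x < g x"
  obtains c where "c \<in> carrier HR" "\<And>x. c (x + 1) = g (c x)"
    "g \<in> carrier PLR \<Longrightarrow> c \<in> carrier PLR"
proof -
  interpret group HR by (rule group_HR)
  have g_less: "g x < g y" if "x < y" for x y
  proof -
    \<comment> \<open>A decreasing \<open>g\<close> would turn \<open>0 < g 0\<close> into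
      \<open>g (g 0) < g 0\<close>, against \<open>above\<close>.\<close>
    have "\<not> strict_antimono_on UNIV g"
      using above[of 0] above[of "g 0"] by (auto simp: monotone_on_def) (meson less_asym)
    with HR_monotone[OF g] that show ?thesis by (auto simp: strict_mono_def)
  qed
  \<comment> \<open>The piece on the interval from \<open>n\<close> to \<open>n + 1\<close>: shift
    back to the unit interval, scale by \<open>g 0\<close>, then apply the \<open>n\<close>-th power
    of \<open>g\<close>.\<close>
  define u where "u n = g [^]\<^bsub>HR\<^esub> n \<circ> (\<lambda>x. g 0 * x + (- g 0 * of_int n))" for n :: int
  define c where "c x = u \<lfloor>x\<rfloor> x" for x
  have g0: "g 0 > 0" by (rule above)
  have pow: "(g [^]\<^bsub>HR\<^esub> (n + 1)) x = g ((g [^]\<^bsub>HR\<^esub> n) x)"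
    "(g [^]\<^bsub>HR\<^esub> (n + 1)) x = (g [^]\<^bsub>HR\<^esub> n) (g x)" for n :: int and x
    using int_pow_mult[OF g, of 1 n] int_pow_mult[OF g, of n 1] int_pow_1[OF g]
    by (simp_all add: add.commute[of 1 n] fun_eq_iff)
  \<comment> \<open>Both endpoints are included: at \<open>n + 1\<close> adjacent pieces agree,
    since the \<open>n\<close>-th power of \<open>g\<close> at \<open>g 0\<close> is the next power
    at \<open>0\<close>. Continuity rests on this.\<close>
  have c_eq: "c x = u n x" if "of_int n \<le> x" "x \<le> of_int n + 1" for n x
  proof (cases "x = of_int n + 1")
    case True
    then have "\<lfloor>x\<rfloor> = n + 1" by simp
    then show ?thesis
      using pow(2)[of n 0] by (simp add: c_def u_def True algebra_simps)
  next
    case False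
    with that have "\<lfloor>x\<rfloor> = n" by (intro floor_unique) auto
    then show ?thesis by (simp add: c_def)
  qed
  have step: "c (x + 1) = g (c x)" for x
    using pow(1)[of "\<lfloor>x\<rfloor>"] by (simp add: c_def u_def algebra_simps)
  have uH: "u n \<in> carrier HR" for n
    unfolding u_def using g0 g by (intro comp_HR affine_HR int_pow_closed) auto
  have germs: "\<forall>\<^sub>F y in at_right x. c y = u \<lfloor>x\<rfloor> y" "\<forall>\<^sub>F y in at_left x. c y = u (\<lceil>x\<rceil> - 1) y" for x
    by (rule piecewise_germs; fact c_eq)+
  have cont: "continuous_on UNIV c"
  proof (intro continuous_at_imp_continuous_on ballI)
    fix x
    have "u n \<midarrow>x\<rightarrow> u n x" for n
      using HR_D(1)[OF uH[of n]] by (simp add: continuous_on_def)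
    then have "(u n \<longlongrightarrow> u n x) (at_left x)" "(u n \<longlongrightarrow> u n x) (at_right x)" for n
      by (auto simp: filterlim_at_split)
    note lim = this
    have cx: "c x = u (\<lceil>x\<rceil> - 1) x" "c x = u \<lfloor>x\<rfloor> x"
      by (intro c_eq; linarith)+
    have "(c \<longlongrightarrow> c x) (at_left x)"
      unfolding cx(1) by (rule tendsto_cong[OF germs(2), THEN iffD2, OF lim(1)])
    moreover have "(c \<longlongrightarrow> c x) (at_right x)"
      unfolding cx(2) by (rule tendsto_cong[OF germs(1), THEN iffD2, OF lim(2)])
    ultimately
    show "isCont c x" by (simp add: isCont_def filterlim_at_split)
  qed
  have mono01: "c x < c y" if "0 \<le> x" "x < y" "y \<le> 1" for x y
    using c_eq[of 0 x] c_eq[of 0 y] that g0 by (simp add: u_def)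
  \<comment> \<open>Monotonicity spreads from the unit interval in both directions: apply
    \<open>g\<close> to move right, cancel it to move left.\<close>
  have mono_piece: "\<forall>x y. of_int n \<le> x \<longrightarrow> x < y \<longrightarrow> y \<le> of_int n + 1 \<longrightarrow> c x < c y" for n :: int
  proof (induction n rule: int_induct[where k = 0])
    case (step1 i)
    show ?case
    proof (intro allI impI)
      fix x y :: real assume "of_int (i + 1) \<le> x" "x < y" "y \<le> of_int (i + 1) + 1"
      with step1 have "c (x - 1) < c (y - 1)" by auto
      then show "c x < c y" using step[of "x - 1"] step[of "y - 1"] g_less by simp
    qed
  next
    case (step2 i)
    show ?case
    proof (intro allI impI)
      fix x y :: real assume "of_int (i - 1) \<le> x" "x < y" "y \<le> of_int (i - 1) + 1"
      with step2 have "c (x + 1) < c (y + 1)" by auto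
      then have "g (c x) < g (c y)" by (simp add: step)
      then show "c x < c y" using g_less by (metis linorder_less_linear less_asym)
    qed
  qed (use mono01 in auto)
  have mono_int: "c (of_int m) \<le> c (of_int n)" if "m \<le> n" for m n :: int
    using that
  proof (induction n rule: int_ge_induct)
    case (step i)
    then show ?case using mono_piece[of i] by force
  qed simp
  have mono: "c x < c y" if "x < y" for x y
  proof (cases "\<lfloor>x\<rfloor> = \<lfloor>y\<rfloor>")
    case True
    then have "y \<le> of_int \<lfloor>x\<rfloor> + 1" by simp
    with that show ?thesis by (intro mono_piece[rule_format, of "\<lfloor>x\<rfloor>"]) auto
  next
    case False
    with that have "\<lfloor>x\<rfloor> + 1 \<le> \<lfloor>y\<rfloor>" using floor_mono[of x y] by linarith
    have "c x < c (of_int (\<lfloor>x\<rfloor> + 1))"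
      by (intro mono_piece[rule_format, of "\<lfloor>x\<rfloor>"]; linarith)
    also have "\<dots> \<le> c (of_int \<lfloor>y\<rfloor>)" by (rule mono_int) fact
    also have "\<dots> \<le> c y"
    proof (cases "of_int \<lfloor>y\<rfloor> = y")
      case False
      then have "of_int \<lfloor>y\<rfloor> < y" using of_int_floor_le[of y] by linarith
      then have "c (of_int \<lfloor>y\<rfloor>) < c y"
        by (intro mono_piece[rule_format, of "\<lfloor>y\<rfloor>"]; linarith)
      then show ?thesis by simp
    qed (simp only: order_refl)
    finally show ?thesis .
  qed
  obtain g' where g': "\<And>x. g (g' x) = x" using HR_inverse[OF g] by blast
  \<comment> \<open>A finite supremum of the range would be fixed by \<open>g\<close>, which moves
    every point upwards. Concretely, a value of \<open>c\<close> above the preimage of the supremum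
    is pushed past it by one more step.\<close>
  have unbounded_above: "\<exists>x. b < c x" for b
  proof (rule ccontr)
    assume "\<not> ?thesis"
    then have bdd: "bdd_above (range c)" by (auto simp: not_less)
    let ?s = "Sup (range c)"
    have "g' ?s < ?s" using above[of "g' ?s"] g' by simp
    then obtain x where "g' ?s < c x"
      using less_cSup_iff[OF _ bdd] by auto
    then have "?s < c (x + 1)" using g_less[of "g' ?s" "c x"] by (simp add: g' step)
    then show False using cSup_upper[OF rangeI bdd, of "x + 1"] by linarith
  qed
  \<comment> \<open>Dually, a value of \<open>c\<close> below the image of the infimum is pulled
    under the infimum by one step back.\<close>
  have unbounded_below: "\<exists>x. c x < b" for b
  proof (rule ccontr)
    assume "\<not> ?thesis"
    then have bdd: "bdd_below (range c)" by (auto simp: not_less)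
    let ?s = "Inf (range c)"
    obtain x where "c x < g ?s"
      using cInf_less_iff[OF _ bdd] above[of ?s] by auto
    then have "g (c (x - 1)) < g ?s" using step[of "x - 1"] by simp
    then have "c (x - 1) < ?s" using g_less by (metis linorder_less_linear less_asym)
    then show False using cInf_lower[OF rangeI bdd, of "x - 1"] by linarith
  qed
  have "surj c"
  proof -
    have "\<exists>x. c x = b" for b
    proof -
      obtain x y where "c x < b" "b < c y" using unbounded_above unbounded_below by blast
      moreover from this have "x \<le> y" using mono[of y x] by fastforce
      ultimately show ?thesis
        using IVT'[of c x b y] continuous_on_subset[OF cont] by force
    qed
    then show ?thesis by (metis surj_def)
  qed
  then have cH: "c \<in> carrier HR"
    using cont mono by (intro HR_I) (auto intro!: strict_mono_imp_inj_on strict_monoI)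
  show ?thesis
  proof
    assume gP: "g \<in> carrier PLR"
    have "u n \<in> carrier PLR" for n
      unfolding u_def using g0 gP
      by (intro comp_PLR affine_PLR subgroup_int_pow_closed[OF subgroup_PLR]) auto
    then show "c \<in> carrier PLR"
      using cH eventually_affine_cong[OF germs(1)] eventually_affine_cong[OF germs(2)]
      by (auto simp: PLR_iff)
  qed (use cH step in auto)
qed

lemma increasing_above_id_two_involutions:
  assumes g: "g \<in> carrier HR" and above: "\<And>x. x < g x"
  obtains s t where "s \<in> involutions HR" "t \<in> involutions HR" "g = s \<circ> t"
    "g \<in> carrier PLR \<Longrightarrow> s \<in> carrier PLR \<and> t \<in> carrier PLR"
proof -
  obtain c where c: "c \<in> carrier HR" "\<And>x. c (x + 1) = g (c x)"
    "g \<in> carrier PLR \<Longrightarrow> c \<in> carrier PLR"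
    using conjugate_to_translation[OF assms] by blast
  obtain c' where c': "c' \<in> carrier HR" "\<And>x. c (c' x) = x" "\<And>x. c' (c x) = x"
    "c \<in> carrier PLR \<Longrightarrow> c' \<in> carrier PLR"
    using HR_inverse[OF c(1)] by blast
  \<comment> \<open>Conjugates of the reflections \<open>a - x\<close>. Those with parameters
    \<open>1\<close> and \<open>0\<close> compose to the translation by \<open>1\<close>, whose
    conjugate is \<open>g\<close>.\<close>
  define r where "r a = c \<circ> (\<lambda>x. (- 1) * x + a) \<circ> c'" for a
  have "r a \<in> carrier HR" for a
    unfolding r_def by (intro comp_HR affine_HR c c') auto
  then have "r a \<in> involutions HR" for a
    by (simp add: involutions_HR r_def c')
  moreover have "g = r 1 \<circ> r 0"
    using c(2)[of "c' x" for x] by (simp add: r_def fun_eq_iff c' add.commute)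
  moreover have "r a \<in> carrier PLR" if "g \<in> carrier PLR" for a
    unfolding r_def using that c c' by (intro comp_PLR affine_PLR) auto
  ultimately show ?thesis using that by blast
qed

section \<open>Products of three and four involutions\<close>

lemma decreasing_three_involutions:
  assumes "strict_antimono_on UNIV f" "f \<in> carrier HR"
  obtains r s t where "{r, s, t} \<subseteq> involutions HR" "f = r \<circ> s \<circ> t"
    "f \<in> carrier PLR \<Longrightarrow> {r, s, t} \<subseteq> carrier PLR"
proof -
  obtain r where r: "r \<in> involutions HR" "strict_antimono_on UNIV r" "\<And>x. f x < r x"
    "f \<in> carrier PLR \<Longrightarrow> r \<in> carrier PLR"
    using decreasing_below_involution[OF assms] by blast
  have rH: "r \<in> carrier HR" and rr: "r (r x) = x" for x
    using r by (auto simp: involutions_HR)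
  have "r \<circ> f \<in> carrier HR" by (intro comp_HR rH assms)
  \<comment> \<open>The decreasing map \<open>r\<close> turns \<open>f x < r x\<close> into
    \<open>r (r x) < r (f x)\<close>, and \<open>r (r x) = x\<close>.\<close>
  moreover have "x < (r \<circ> f) x" for x
    using r(2) r(3)[of x] rr[of x] by (metis comp_apply monotone_on_def UNIV_I)
  ultimately obtain s t where st: "s \<in> involutions HR" "t \<in> involutions HR" "r \<circ> f = s \<circ> t"
    "r \<circ> f \<in> carrier PLR \<Longrightarrow> s \<in> carrier PLR \<and> t \<in> carrier PLR"
    using increasing_above_id_two_involutions by blast
  show ?thesis
  proof
    show "{r, s, t} \<subseteq> involutions HR" using r st by simp
    show "f = r \<circ> s \<circ> t" using st(3) rr by (metis (no_types, lifting) comp_apply comp_assoc ext)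
    show "{r, s, t} \<subseteq> carrier PLR" if "f \<in> carrier PLR"
      using that r st comp_PLR by blast
  qed
qed

lemma orientation_reversing_alt:
  "orientation_reversing G = {f \<in> carrier G. strict_antimono_on UNIV f}"
  by (auto simp: orientation_reversing_def monotone_on_def)

text \<open>This is the group-theoretic bookkeeping common to H(R) and PL(R); the analysis enters
  only through \<open>three\<close>.\<close>

lemma inv_prods_3_4:
  assumes sub: "subgroup C HR" and minus: "uminus \<in> C" and G: "G = HR\<lparr>carrier := C\<rparr>"
    and three: "\<And>f. f \<in> C \<Longrightarrow> strict_antimono_on UNIV f \<Longrightarrow>
      \<exists>r s t. {r, s, t} \<subseteq> involutions HR \<inter> C \<and> f = r \<circ> s \<circ> t"
  shows "orientation_reversing G \<subset> inv_prods 3 G \<and> carrier G = inv_prods 4 G"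
proof -
  have CH: "C \<subseteq> carrier HR" using sub by (rule subgroup.subset)
  have inv: "involutions G = involutions HR \<inter> C"
    using CH by (auto simp: involutions_def G)
  have prods: "inv_prods n G = {foldr (\<circ>) ts id | ts. length ts = n \<and> set ts \<subseteq> involutions HR \<inter> C}" for n
    unfolding inv_prods_def inv by (simp add: G HR_def)
  have id: "id \<in> involutions HR \<inter> C"
    using subgroup.one_closed[OF sub] CH by (auto simp: involutions_HR)
  have uminus: "uminus \<in> involutions HR \<inter> C"
    using minus CH by (auto simp: involutions_HR)
  \<comment> \<open>The fourth factor \<open>q\<close> stays free: \<open>id\<close> pads a
    decreasing map to length four, and \<open>uminus\<close> handles the increasing ones.\<close>
  have rev: "f \<in> inv_prods 3 G" "f \<circ> q \<in> inv_prods 4 G"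
    if f: "f \<in> C" "strict_antimono_on UNIV f" and q: "q \<in> involutions HR \<inter> C" for f q
  proof -
    obtain r s t where *: "{r, s, t} \<subseteq> involutions HR \<inter> C" "f = r \<circ> s \<circ> t"
      using three[OF f] by blast
    have "f = foldr (\<circ>) [r, s, t] id" "f \<circ> q = foldr (\<circ>) [r, s, t, q] id"
      using * by (simp_all add: comp_assoc)
    then show "f \<in> inv_prods 3 G" "f \<circ> q \<in> inv_prods 4 G"
      unfolding prods using * q
      by (force intro!: exI[of _ "[r, s, t]"], force intro!: exI[of _ "[r, s, t, q]"])
  qed
  have "orientation_reversing G \<subseteq> inv_prods 3 G"
    using rev(1)[OF _ _ id] by (auto simp: orientation_reversing_alt G)
  \<comment> \<open>The identity witnesses strictness of the inclusion.\<close>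
  moreover have "id = foldr (\<circ>) [id, id, id] id" by simp
  then have "id \<in> inv_prods 3 G"
    unfolding prods using id by (force intro!: exI[of _ "[id, id, id]"])
  moreover have "id \<notin> orientation_reversing G"
    by (auto simp: orientation_reversing_def not_less not_le intro: zero_less_one)
  moreover have "C \<subseteq> inv_prods 4 G"
  proof
    fix f assume f: "f \<in> C"
    show "f \<in> inv_prods 4 G"
    proof (cases "strict_antimono_on UNIV f")
      case True
      then show ?thesis using rev(2)[OF f True id] by simp
    next
      case False
      then have "strict_mono f" using HR_monotone CH f by blast
      then have "strict_antimono_on UNIV (f \<circ> uminus)"
        by (auto simp: monotone_on_def)
      moreover have "f \<circ> uminus \<in> C"
        using subgroup.m_closed[OF sub f minus] by simp
      ultimately have "(f \<circ> uminus) \<circ> uminus \<in> inv_prods 4 G"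
        using rev(2) uminus by blast
      then show ?thesis by (simp add: comp_def)
    qed
  qed
  moreover have "foldr (\<circ>) ts id \<in> C" if "set ts \<subseteq> involutions HR \<inter> C" for ts
    using that
  proof (induction ts)
    case Nil
    then show ?case using id by (simp add: id_def)
  next
    case (Cons t ts)
    then have ts: "t \<in> C" "set ts \<subseteq> involutions HR \<inter> C" by auto
    have "t \<otimes>\<^bsub>HR\<^esub> foldr (\<circ>) ts id \<in> C"
      by (rule subgroup.m_closed[OF sub ts(1) Cons.IH[OF ts(2)]])
    moreover have "foldr (\<circ>) (t # ts) id = t \<circ> foldr (\<circ>) ts id" by simp
    ultimately show ?case by (simp only: HR_simps)
  qed
  then have "inv_prods 4 G \<subseteq> C" unfolding prods by blast
  ultimately show ?thesis by (auto simp: G)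
qed

section \<open>An obstruction for finitely many breakpoints\<close>

text \<open>
  The product of the slopes at the two ends of the line is multiplicative, and it is 1 for an
  involution, whose graph is symmetric in the diagonal.
\<close>
definition reciprocal_ends :: "(real \<Rightarrow> real) set" where
  "reciprocal_ends = {f. \<exists>a b c d. (\<forall>\<^sub>F x in at_top. f x = a * x + b) \<and>
     (\<forall>\<^sub>F x in at_bot. f x = c * x + d) \<and> a * c = 1}"

lemma filterlim_affine:
  fixes a b :: real
  shows "a > 0 \<Longrightarrow> filterlim (\<lambda>x. a * x + b) at_top at_top"
    "a > 0 \<Longrightarrow> filterlim (\<lambda>x. a * x + b) at_bot at_bot"
    "a < 0 \<Longrightarrow> filterlim (\<lambda>x. a * x + b) at_bot at_top"
    "a < 0 \<Longrightarrow> filterlim (\<lambda>x. a * x + b) at_top at_bot"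
  by real_asymp+

lemma eventually_affine_comp:
  fixes f g :: "real \<Rightarrow> real"
  assumes g: "\<forall>\<^sub>F x in F. g x = a * x + b" and lim: "filterlim (\<lambda>x. a * x + b) E F"
    and f: "\<forall>\<^sub>F x in E. f x = c * x + d"
  shows "\<forall>\<^sub>F x in F. (f \<circ> g) x = (c * a) * x + (c * b + d)"
proof -
  have "\<forall>\<^sub>F x in F. f (a * x + b) = c * (a * x + b) + d"
    using eventually_compose_filterlim[OF f lim] .
  with g show ?thesis by eventually_elim (simp add: algebra_simps)
qed

text \<open>If \<open>g\<close> increases near the ends, equal ends are paired; if it decreases, it
  swaps the ends and the slopes of \<open>f\<close> are paired crosswise. Either way all four slopes
  are multiplied together.\<close>

lemma reciprocal_ends_comp:
  assumes "f \<in> reciprocal_ends" "g \<in> reciprocal_ends"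
  shows "f \<circ> g \<in> reciprocal_ends"
proof -
  obtain a b c d where f: "\<forall>\<^sub>F x in at_top. f x = a * x + b" "\<forall>\<^sub>F x in at_bot. f x = c * x + d" "a * c = 1"
    using assms(1) by (auto simp: reciprocal_ends_def)
  obtain a' b' c' d' where g: "\<forall>\<^sub>F x in at_top. g x = a' * x + b'"
    "\<forall>\<^sub>F x in at_bot. g x = c' * x + d'" "a' * c' = 1"
    using assms(2) by (auto simp: reciprocal_ends_def)
  have prod: "(a * a') * (c * c') = 1" "(c * a') * (a * c') = 1"
    using f(3) g(3) by (simp_all add: algebra_simps) (metis mult.assoc mult.left_commute mult_1)+
  \<comment> \<open>A product of \<open>1\<close> forces both end slopes of \<open>g\<close> to have
    the same sign.\<close>
  have "a' > 0 \<and> c' > 0 \<or> a' < 0 \<and> c' < 0"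
    using g(3) by (metis zero_less_mult_iff zero_less_one)
  then show ?thesis
  proof
    assume "a' > 0 \<and> c' > 0"
    then have "\<forall>\<^sub>F x in at_top. (f \<circ> g) x = (a * a') * x + (a * b' + b)"
      "\<forall>\<^sub>F x in at_bot. (f \<circ> g) x = (c * c') * x + (c * d' + d)"
      using f g by (blast intro: eventually_affine_comp filterlim_affine)+
    with prod show ?thesis unfolding reciprocal_ends_def by blast
  next
    assume "a' < 0 \<and> c' < 0"
    then have "\<forall>\<^sub>F x in at_top. (f \<circ> g) x = (c * a') * x + (c * b' + d)"
      "\<forall>\<^sub>F x in at_bot. (f \<circ> g) x = (a * c') * x + (a * d' + b)"
      using f g by (blast intro: eventually_affine_comp filterlim_affine)+
    with prod show ?thesis unfolding reciprocal_ends_def by blast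
  qed
qed

lemma affine_unique_at_top:
  fixes a b c d :: real
  assumes "\<forall>\<^sub>F x in at_top. a * x + b = c * x + d"
  shows "a = c" "b = d"
proof -
  obtain N where N: "\<And>x. x \<ge> N \<Longrightarrow> a * x + b = c * x + d"
    using assms by (auto simp: eventually_at_top_linorder)
  show "a = c" using N[of N] N[of "N + 1"] by (simp add: algebra_simps)
  then show "b = d" using N[of N] by simp
qed

text \<open>Outside a bound for the finitely many breakpoints, \<open>f\<close> is locally affine on
  two rays, hence affine on each.\<close>

lemma finite_breakpoints_affine_ends:
  assumes "finite (breakpoints f)"
  shows "eventually_affine f at_top" "eventually_affine f at_bot"
proof -
  obtain M where M: "\<forall>x\<in>breakpoints f. norm x \<le> M"
    using finite_imp_bounded[OF assms] by (auto simp: bounded_iff)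
  have "\<exists>a b. \<forall>x\<in>{M<..}. f x = a * x + b"
    using M by (intro locally_affine_imp_affine) (force simp: breakpoints_def)+
  then show "eventually_affine f at_top"
    unfolding eventually_affine_def eventually_at_top_dense by blast
  have "\<exists>a b. \<forall>x\<in>{..<-M}. f x = a * x + b"
    using M by (intro locally_affine_imp_affine) (force simp: breakpoints_def)+
  then show "eventually_affine f at_bot"
    unfolding eventually_affine_def eventually_at_bot_dense by blast
qed

text \<open>An increasing involution is the identity. A decreasing one sends the upper end to the
  lower end, so comparing slopes in \<open>t (t x) = x\<close> gives
  \<open>c * a = 1\<close>.\<close>

lemma involution_reciprocal_ends:
  assumes t: "t \<in> involutions HR" and fin: "finite (breakpoints t)"
  shows "t \<in> reciprocal_ends"
proof -
  have tt: "t (t x) = x" for x using t by (simp add: involutions_HR)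
  obtain a b where ab: "\<forall>\<^sub>F x in at_top. t x = a * x + b"
    using finite_breakpoints_affine_ends[OF fin] by (auto simp: eventually_affine_def)
  obtain c d where cd: "\<forall>\<^sub>F x in at_bot. t x = c * x + d"
    using finite_breakpoints_affine_ends[OF fin] by (auto simp: eventually_affine_def)
  from t have "strict_mono t \<or> strict_antimono_on UNIV t"
    by (simp add: involutions_HR HR_monotone)
  then show ?thesis
  proof
    assume "strict_mono t"
    \<comment> \<open>From \<open>x < t x\<close> an increasing \<open>t\<close> would give
      \<open>t x < t (t x) = x\<close>, and likewise for the reverse inequality.\<close>
    then have "t x = x" for x
      using tt by (metis linorder_less_linear order_less_asym strict_mono_less)
    then show ?thesis
      unfolding reciprocal_ends_def
      by (intro CollectI exI[of _ 1] exI[of _ 0]) simp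
  next
    assume anti: "strict_antimono_on UNIV t"
    obtain N where N: "\<And>x. x \<ge> N \<Longrightarrow> t x = a * x + b"
      using ab by (auto simp: eventually_at_top_linorder)
    have "t (N + 1) < t N" using anti by (auto simp: monotone_on_def)
    then have "a < 0" using N[of N] N[of "N + 1"] by (simp add: algebra_simps)
    have "\<forall>\<^sub>F x in at_top. (t \<circ> t) x = (c * a) * x + (c * b + d)"
      by (rule eventually_affine_comp[OF ab filterlim_affine(3)[OF \<open>a < 0\<close>] cd])
    then have "\<forall>\<^sub>F x in at_top. (c * a) * x + (c * b + d) = 1 * x + 0"
      by (simp add: tt eq_commute)
    then have "c * a = 1" by (rule affine_unique_at_top)
    then have "a * c = 1" by (simp add: mult.commute)
    with ab cd show ?thesis unfolding reciprocal_ends_def by blast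
  qed
qed

text \<open>Viewing these products as the generated subgroup allows induction over its elements;
  inverses of generators cause no trouble, as an involution is its own inverse.\<close>

lemma inv_prods_inf_PLFR_reciprocal_ends:
  assumes "f \<in> inv_prods_inf PLFR"
  shows "f \<in> carrier PLFR" "f \<in> reciprocal_ends"
proof -
  have gen: "f \<in> generate PLFR (involutions PLFR)"
    using assms group.inv_prods_inf_eq_generate[OF group_PLFR] by simp
  interpret group PLFR by (rule group_PLFR)
  have inv: "t \<in> reciprocal_ends" if "t \<in> involutions PLFR" for t
    using that by (intro involution_reciprocal_ends) (auto simp: involutions_def PLFR_def)
  show "f \<in> carrier PLFR"
    using generate_in_carrier[OF _ gen] by (auto simp: involutions_def)
  from gen show "f \<in> reciprocal_ends"
  proof (induction rule: generate.induct)
    case one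
    have "\<one>\<^bsub>PLFR\<^esub> \<in> involutions PLFR" by (simp add: involutions_def)
    then show ?case by (rule inv)
  next
    case (incl h)
    then show ?case by (rule inv)
  next
    case (inv h)
    then have "inv\<^bsub>PLFR\<^esub> h = h" by (auto simp: involutions_def intro: inv_equality)
    with inv show ?case using \<open>\<And>t. t \<in> involutions PLFR \<Longrightarrow> t \<in> reciprocal_ends\<close> by simp
  next
    case (eng h1 h2)
    have "h1 \<otimes>\<^bsub>PLFR\<^esub> h2 = h1 \<circ> h2" by (simp add: PLFR_def HR_def)
    with reciprocal_ends_comp[OF eng.IH] show ?case by (simp only:)
  qed
qed

section \<open>A map with one breakpoint that violates the obstruction\<close>

lemma kink_PLFR: "(\<lambda>x. max x (2 * x)) \<in> carrier PLFR"
proof -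
  let ?f = "\<lambda>x :: real. max x (2 * x)"
  have "?f \<in> carrier HR"
  proof (rule HR_I)
    show "surj ?f"
      by (rule surjI[of _ "\<lambda>y. min y (y / 2)"]) (auto simp: max_def min_def)
    show "inj ?f" by (rule injI) (auto simp: max_def split: if_splits)
  qed (intro continuous_intros)
  moreover have "locally_affine_at ?f x" if "x \<noteq> 0" for x
  proof (cases "x > 0")
    case True
    then show ?thesis unfolding locally_affine_at_def
      by (intro exI[of _ "{0<..}"] exI[of _ 2] exI[of _ 0]) auto
  next
    case False
    with that show ?thesis unfolding locally_affine_at_def
      by (intro exI[of _ "{..<0}"] exI[of _ 1] exI[of _ 0]) auto
  qed
  then have "breakpoints ?f \<subseteq> {0}" by (auto simp: breakpoints_def)
  ultimately show ?thesis by (auto simp: PLFR_def intro: finite_subset)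
qed

text \<open>The slopes at the upper and lower end are \<open>2\<close> and \<open>1\<close>, with
  product \<open>2\<close>.\<close>

lemma kink_not_reciprocal_ends: "(\<lambda>x. max x (2 * x)) \<notin> reciprocal_ends"
proof
  assume "(\<lambda>x. max x (2 * x)) \<in> reciprocal_ends"
  then obtain a b c d :: real where
    top: "\<forall>\<^sub>F x in at_top. max x (2 * x) = a * x + b" and
    bot: "\<forall>\<^sub>F x in at_bot. max x (2 * x) = c * x + d" and ac: "a * c = 1"
    by (auto simp: reciprocal_ends_def)
  have "\<forall>\<^sub>F x in at_top. 2 * x + 0 = a * x + b"
    using top eventually_gt_at_top[of 0] by eventually_elim simp
  then have "2 = a" by (rule affine_unique_at_top)
  \<comment> \<open>Substituting \<open>- x\<close> moves the lower end to the upper one, where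
    uniqueness of affine germs is available.\<close>
  have "\<forall>\<^sub>F x in at_top. - x = c * (- x) + d"
    using bot[unfolded at_bot_mirror eventually_filtermap] eventually_gt_at_top[of 0]
  proof eventually_elim
    case (elim x)
    then have "max (- x) (2 * (- x)) = - x" by simp
    with elim show ?case by linarith
  qed
  then have "\<forall>\<^sub>F x in at_top. (- 1) * x + 0 = (- c) * x + d" by simp
  then have "- 1 = - c" by (rule affine_unique_at_top)
  with \<open>2 = a\<close> ac show False by simp
qed

theorem theorem1p4:
  shows "(orientation_reversing HR \<subset> inv_prods 3 HR \<and> carrier HR = inv_prods 4 HR)
    \<and> inv_prods_inf PLFR \<subset> carrier PLFR
    \<and> (orientation_reversing PLR \<subset> inv_prods 3 PLR \<and> carrier PLR = inv_prods 4 PLR)"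
proof (intro conjI[OF _ conjI])
  have uminus: "uminus \<in> carrier HR" "uminus \<in> carrier PLR"
    using affine_HR[of "-1" 0] affine_PLR[of "-1" 0] by simp_all
  show "orientation_reversing HR \<subset> inv_prods 3 HR \<and> carrier HR = inv_prods 4 HR"
  proof (rule inv_prods_3_4[OF group.subgroup_self[OF group_HR] uminus(1)])
    fix f assume "f \<in> carrier HR" "strict_antimono_on UNIV f"
    then obtain r s t where "{r, s, t} \<subseteq> involutions HR" "f = r \<circ> s \<circ> t"
      using decreasing_three_involutions by blast
    moreover have "involutions HR \<subseteq> carrier HR" by (auto simp: involutions_HR)
    ultimately show "\<exists>r s t. {r, s, t} \<subseteq> involutions HR \<inter> carrier HR \<and> f = r \<circ> s \<circ> t"
      by blast
  qed simp
  show "orientation_reversing PLR \<subset> inv_prods 3 PLR \<and> carrier PLR = inv_prods 4 PLR"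
  proof (rule inv_prods_3_4[OF subgroup_PLR uminus(2)])
    fix f assume f: "f \<in> carrier PLR" "strict_antimono_on UNIV f"
    then have "f \<in> carrier HR" by (simp add: PLR_def)
    then obtain r s t where "{r, s, t} \<subseteq> involutions HR" "f = r \<circ> s \<circ> t" "{r, s, t} \<subseteq> carrier PLR"
      using decreasing_three_involutions[OF f(2)] f(1) by blast
    then show "\<exists>r s t. {r, s, t} \<subseteq> involutions HR \<inter> carrier PLR \<and> f = r \<circ> s \<circ> t"
      by blast
  qed (simp add: PLR_def)
  show "inv_prods_inf PLFR \<subset> carrier PLFR"
  proof
    show "inv_prods_inf PLFR \<subseteq> carrier PLFR"
      using inv_prods_inf_PLFR_reciprocal_ends(1) by blast
    show "inv_prods_inf PLFR \<noteq> carrier PLFR"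
      using inv_prods_inf_PLFR_reciprocal_ends(2) kink_PLFR kink_not_reciprocal_ends by metis
  qed
qed

end
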